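(* Let $G$ be a graph on $n$ vertices with $\alpha(G)\le 2$. Then $G$ contains a strong immersion of $K_{\lceil n/3\rceil}$.
   Context: All graphs are finite and simple (no loops, no parallel edges). $K_t$ denotes the complete graph on $t$ vertices and $\alpha(G)$ the independence number of $G$ (maximum size of an independent set). A graph $G$ contains an immersion of a graph $H$ if there is an injective function $\phi:V(H)\to V(G)$ such that: (1) for every edge $uv\in E(H)$ there is a path $P_{uv}$ in $G$ connecting $\phi(u)$ and $\phi(v)$; (2) the paths $\{P_{uv}: uv\in E(H)\}$ are pairwise edge-disjoint. The immersion is strong if moreover the paths $P_{uv}$ are internally disjoint from $\phi(V(H))$, i.e. no internal vertex of any $P_{uv}$ lies in $\phi(V(H))$. *)

theory Defs
  imports Complex_Main "Graph_Theory.Graph_Theory"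
begin

text \<open>
  A finite simple graph is a digraph satisfying the locale \<^locale>\<open>graph\<close>, in which every
  undirected edge is represented by a pair of opposite arcs. Edge-disjointness has to ignore
  the orientation of these arcs, hence the following unordered edges.
\<close>

definition edges_of :: "('a, 'b) pre_digraph \<Rightarrow> 'a set set" where
  "edges_of G = {{u, v} | u v. u \<rightarrow>\<^bsub>G\<^esub> v}"

definition independent_set :: "('a, 'b) pre_digraph \<Rightarrow> 'a set \<Rightarrow> bool" where
  "independent_set G S \<longleftrightarrow> S \<subseteq> verts G \<and> (\<forall>u\<in>S. \<forall>v\<in>S. \<not> u \<rightarrow>\<^bsub>G\<^esub> v)"

definition independence_number :: "('a, 'b) pre_digraph \<Rightarrow> nat" where
  "independence_number G = Max {card S | S. independent_set G S}"

definition path_edges :: "'a vwalk \<Rightarrow> 'a set set" where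
  "path_edges p = {{u, v} | u v. (u, v) \<in> set (vwalk_arcs p)}"

definition internal_verts :: "'a vwalk \<Rightarrow> 'a set" where
  "internal_verts p = set p - {hd p, last p}"

text \<open>
  The paths are indexed by unordered edges of \<open>H\<close>, so that there is one path per edge and not
  one per arc.
\<close>

definition is_immersion ::
  "('c, 'd) pre_digraph \<Rightarrow> ('a, 'b) pre_digraph \<Rightarrow> ('c \<Rightarrow> 'a) \<Rightarrow> ('c set \<Rightarrow> 'a vwalk) \<Rightarrow> bool" where
  "is_immersion H G \<phi> P \<longleftrightarrow>
     inj_on \<phi> (verts H) \<and> \<phi> ` verts H \<subseteq> verts G \<and>
     (\<forall>e\<in>edges_of H. vpath (P e) G \<and> {hd (P e), last (P e)} = \<phi> ` e) \<and>
     (\<forall>e\<in>edges_of H. \<forall>f\<in>edges_of H. e \<noteq> f \<longrightarrow> path_edges (P e) \<inter> path_edges (P f) = {})"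

definition is_strong_immersion ::
  "('c, 'd) pre_digraph \<Rightarrow> ('a, 'b) pre_digraph \<Rightarrow> ('c \<Rightarrow> 'a) \<Rightarrow> ('c set \<Rightarrow> 'a vwalk) \<Rightarrow> bool" where
  "is_strong_immersion H G \<phi> P \<longleftrightarrow>
     is_immersion H G \<phi> P \<and> (\<forall>e\<in>edges_of H. internal_verts (P e) \<inter> \<phi> ` verts H = {})"

definition contains_strong_immersion ::
  "('a, 'b) pre_digraph \<Rightarrow> ('c, 'd) pre_digraph \<Rightarrow> bool" where
  "contains_strong_immersion G H \<longleftrightarrow> (\<exists>\<phi> P. is_strong_immersion H G \<phi> P)"

definition complete_graph :: "nat \<Rightarrow> nat pair_pre_digraph" where
  "complete_graph t = \<lparr>pverts = {..<t}, parcs = {(u, v). u < t \<and> v < t \<and> u \<noteq> v}\<rparr>"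

lemma complete_digraph_complete_graph: "complete_digraph t (with_proj (complete_graph t))"
  unfolding complete_digraph_pair_def by (auto simp: complete_graph_def)

end

theory Submission
  imports Defs
begin

text \<open>
  Let \<open>t = \<lceil>n/3\<rceil>\<close>, so that \<open>n + 2 \<ge> 3t\<close>. As there are no three pairwise non-adjacent vertices,
  the non-neighbours of any vertex form a clique. If some vertex has at least \<open>t\<close> non-neighbours,
  then \<open>G\<close> even contains \<open>K\<^sub>t\<close> as a subgraph.

  Otherwise every vertex has at most \<open>t - 1\<close> non-neighbours, and then \<^emph>\<open>every\<close> set \<open>T\<close> of \<open>t\<close>
  vertices is the set of branch vertices of a strong immersion, in which adjacent pairs of \<open>T\<close> are
  joined by their edge and every non-adjacent pair \<open>{u, v}\<close> by a path \<open>u, w, v\<close> with a midpoint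
  \<open>w\<close> outside \<open>T\<close>. Two such paths share an edge only if they have the same midpoint and a common
  end, so the choice of midpoints is a proper list edge colouring of the complement of \<open>G[T]\<close>, the
  list of \<open>{u, v}\<close> consisting of the common neighbours of \<open>u\<close> and \<open>v\<close> outside \<open>T\<close>. Greedy
  colouring succeeds: if \<open>u\<close> and \<open>v\<close> have \<open>d\<^sub>u\<close> and \<open>d\<^sub>v\<close> non-neighbours in \<open>T\<close>, then at most
  \<open>d\<^sub>u + d\<^sub>v - 2\<close> other non-adjacent pairs in \<open>T\<close> meet \<open>{u, v}\<close>, whereas the list has at least
  \<open>(n - t) - (t - 1 - d\<^sub>u) - (t - 1 - d\<^sub>v) = (n + 2 - 3t) + d\<^sub>u + d\<^sub>v \<ge> d\<^sub>u + d\<^sub>v\<close> elements.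
  The lemma \<open>strong_immersion_of_few_non_neighbours\<close> carries out this count.
\<close>

definition non_neighbours :: "('a, 'b) pre_digraph \<Rightarrow> 'a \<Rightarrow> 'a set" where
  "non_neighbours G u = {x \<in> verts G. x \<noteq> u \<and> \<not> u \<rightarrow>\<^bsub>G\<^esub> x}"

text \<open>
  Colour the objects one after the other: a list longer than the number of conflicts of its object
  always has a colour left.
\<close>

lemma greedy_list_colouring:
  assumes "finite E"
    and "\<And>e f. conflict e f \<Longrightarrow> conflict f e"
    and "\<And>e. e \<in> E \<Longrightarrow> card {f \<in> E. f \<noteq> e \<and> conflict e f} < card (L e)"
  shows "\<exists>c. (\<forall>e\<in>E. c e \<in> L e) \<and> (\<forall>e\<in>E. \<forall>f\<in>E. e \<noteq> f \<longrightarrow> conflict e f \<longrightarrow> c e \<noteq> c f)"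
  using assms(1,3)
proof (induction E rule: finite_induct)
  case empty
  then show ?case by simp
next
  case (insert e E)
  have "card {f \<in> E. f \<noteq> e' \<and> conflict e' f} < card (L e')" if "e' \<in> E" for e'
  proof -
    have "card {f \<in> E. f \<noteq> e' \<and> conflict e' f} \<le> card {f \<in> insert e E. f \<noteq> e' \<and> conflict e' f}"
      by (rule card_mono) (use insert.hyps in auto)
    also have "\<dots> < card (L e')" using insert.prems that by blast
    finally show ?thesis .
  qed
  then obtain c where list: "\<forall>e\<in>E. c e \<in> L e"
    and proper: "\<forall>e\<in>E. \<forall>f\<in>E. e \<noteq> f \<longrightarrow> conflict e f \<longrightarrow> c e \<noteq> c f"
    using insert.IH by blast
  let ?used = "c ` {f \<in> E. conflict e f}"
  have "card ?used \<le> card {f \<in> E. conflict e f}"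
    by (rule card_image_le) (use insert.hyps in auto)
  also have "\<dots> = card {f \<in> insert e E. f \<noteq> e \<and> conflict e f}"
    by (rule arg_cong[of _ _ card]) (use insert.hyps in auto)
  also have "\<dots> < card (L e)" using insert.prems by blast
  finally have "\<not> L e \<subseteq> ?used"
    using card_mono[of ?used "L e"] insert.hyps by auto
  then obtain x where x: "x \<in> L e" "x \<notin> ?used" by blast
  show ?case
  proof (intro exI[of _ "c(e := x)"] conjI ballI impI)
    fix e' assume "e' \<in> insert e E"
    then show "(c(e := x)) e' \<in> L e'" using x list by auto
  next
    fix e1 e2 assume "e1 \<in> insert e E" "e2 \<in> insert e E" "e1 \<noteq> e2" "conflict e1 e2"
    moreover from this have "conflict e2 e1" using assms(2) by blast
    ultimately show "(c(e := x)) e1 \<noteq> (c(e := x)) e2"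
      using x(2) proper by auto
  qed
qed

lemma edges_of_complete_graph:
  "edges_of (with_proj (complete_graph t)) = {{i, j} | i j. i < t \<and> j < t \<and> i \<noteq> j}"
  by (auto simp: edges_of_def complete_graph_def arcs_ends_def arc_to_ends_def with_proj_def)

text \<open>
  The edge-disjointness of the paths \<open>u, w, v\<close> is reduced to a condition on their midpoints \<open>w\<close>.
  It suffices to compare two paths with a common end: since midpoints lie outside \<open>T\<close>, an edge of
  such a path determines which of its ends lies in \<open>T\<close>.
\<close>

lemma strong_immersion_through_midpoints:
  fixes G :: "('a, 'b) pre_digraph"
  assumes "graph G" and T: "T \<subseteq> verts G"
    and mid: "\<And>u v. \<lbrakk>u \<in> T; v \<in> T; u \<noteq> v; \<not> u \<rightarrow>\<^bsub>G\<^esub> v\<rbrakk> \<Longrightarrow>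
      m {u, v} \<in> verts G - T \<and> u \<rightarrow>\<^bsub>G\<^esub> m {u, v} \<and> v \<rightarrow>\<^bsub>G\<^esub> m {u, v}"
    and distinct_mid: "\<And>u v w. \<lbrakk>u \<in> T; v \<in> T; w \<in> T; u \<noteq> v; u \<noteq> w; v \<noteq> w;
      \<not> u \<rightarrow>\<^bsub>G\<^esub> v; \<not> u \<rightarrow>\<^bsub>G\<^esub> w\<rbrakk> \<Longrightarrow> m {u, v} \<noteq> m {u, w}"
  shows "contains_strong_immersion G (with_proj (complete_graph (card T)))"
proof -
  interpret graph G by fact
  let ?H = "with_proj (complete_graph (card T))"
  have verts_H: "verts ?H = {..<card T}"
    by (simp add: complete_graph_def)
  have "finite T" using T finite_subset finite_verts by blast
  then obtain \<phi> where \<phi>: "bij_betw \<phi> {..<card T} T"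
    using ex_bij_betw_nat_finite[of T] by (auto simp: atLeast0LessThan)
  have inj: "inj_on \<phi> {..<card T}" and img: "\<phi> ` {..<card T} = T"
    using \<phi> by (auto simp: bij_betw_def)
  have ends: "\<exists>u v. \<phi> ` e = {u, v} \<and> u \<in> T \<and> v \<in> T \<and> u \<noteq> v" if e: "e \<in> edges_of ?H" for e
  proof -
    obtain i j where "e = {i, j}" "i < card T" "j < card T" "i \<noteq> j"
      using e unfolding edges_of_complete_graph by blast
    then show ?thesis
      using img inj by (intro exI[of _ "\<phi> i"] exI[of _ "\<phi> j"]) (auto dest: inj_onD)
  qed
  have img_neq: "\<phi> ` e \<noteq> \<phi> ` f" if "e \<in> edges_of ?H" "f \<in> edges_of ?H" "e \<noteq> f" for e f
  proof -
    have "e \<subseteq> {..<card T}" "f \<subseteq> {..<card T}"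
      using that unfolding edges_of_complete_graph by auto
    then show ?thesis using inj_on_image_eq_iff[OF inj] that by blast
  qed
  \<comment> \<open>The edges of the path joining the pair \<open>d\<close>, which do not depend on the direction of the path.\<close>
  define E where
    "E d = (if d \<in> edges_of G then {d} else (\<lambda>u. {u, m d}) ` d)" for d
  have edge_iff: "{u, v} \<in> edges_of G \<longleftrightarrow> u \<rightarrow>\<^bsub>G\<^esub> v" for u v
    using graph_symmetric by (auto simp: edges_of_def doubleton_eq_iff)
  have "\<exists>p. vpath p G \<and> {hd p, last p} = \<phi> ` e \<and> path_edges p = E (\<phi> ` e) \<and>
          internal_verts p \<inter> T = {}" if e: "e \<in> edges_of ?H" for e
  proof -
    obtain u v where uv: "\<phi> ` e = {u, v}" "u \<in> T" "v \<in> T" "u \<noteq> v"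
      using ends[OF e] by blast
    show ?thesis
    proof (cases "u \<rightarrow>\<^bsub>G\<^esub> v")
      case True
      then show ?thesis using uv T edge_iff[of u v]
        by (intro exI[of _ "[u, v]"])
          (auto simp: vpath_def vwalk_def path_edges_def internal_verts_def E_def)
    next
      case False
      let ?w = "m {u, v}"
      have w: "?w \<in> verts G - T" "u \<rightarrow>\<^bsub>G\<^esub> ?w" "v \<rightarrow>\<^bsub>G\<^esub> ?w" using mid uv False by blast+
      have "path_edges [u, ?w, v] = E {u, v}"
        using False edge_iff[of u v] by (auto simp: path_edges_def E_def)
      then show ?thesis using uv T w graph_symmetric
        by (intro exI[of _ "[u, ?w, v]"])
          (auto simp: vpath_def vwalk_def internal_verts_def)
    qed
  qed
  then obtain P where P: "\<And>e. e \<in> edges_of ?H \<Longrightarrow> vpath (P e) G \<and> {hd (P e), last (P e)} = \<phi> ` e \<and>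
      path_edges (P e) = E (\<phi> ` e) \<and> internal_verts (P e) \<inter> T = {}"
    by metis
  have "E (\<phi> ` e) \<inter> E (\<phi> ` f) = {}"
    if e: "e \<in> edges_of ?H" and f: "f \<in> edges_of ?H" and "e \<noteq> f" for e f
  proof -
    obtain u v where uv: "\<phi> ` e = {u, v}" "u \<in> T" "v \<in> T" "u \<noteq> v" using ends[OF e] by blast
    obtain x y where xy: "\<phi> ` f = {x, y}" "x \<in> T" "y \<in> T" "x \<noteq> y" using ends[OF f] by blast
    have neq: "{u, v} \<noteq> {x, y}" using img_neq[OF that] uv xy by simp
    have same_mid: False
      if "a \<in> T" "b \<in> T" "c \<in> T" "a \<noteq> b" "a \<noteq> c" "{a, b} \<noteq> {a, c}"
        "\<not> a \<rightarrow>\<^bsub>G\<^esub> b" "\<not> a \<rightarrow>\<^bsub>G\<^esub> c" "m {a, b} = m {a, c}" for a b c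
      using distinct_mid[of a b c] that by auto
    have out_uv: "m {u, v} \<notin> T" "\<not> v \<rightarrow>\<^bsub>G\<^esub> u" if "\<not> u \<rightarrow>\<^bsub>G\<^esub> v"
      using mid[of u v] that uv graph_symmetric by blast+
    have out_xy: "m {x, y} \<notin> T" "\<not> y \<rightarrow>\<^bsub>G\<^esub> x" if "\<not> x \<rightarrow>\<^bsub>G\<^esub> y"
      using mid[of x y] that xy graph_symmetric by blast+
    show ?thesis
    proof (rule ccontr)
      assume "\<not> ?thesis"
      then obtain d where d: "d \<in> E {u, v}" "d \<in> E {x, y}" using uv xy by auto
      show False
      proof (cases "u \<rightarrow>\<^bsub>G\<^esub> v \<or> x \<rightarrow>\<^bsub>G\<^esub> y")
        case True
        \<comment> \<open>An edge of \<open>G[T]\<close> cannot contain a midpoint.\<close>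
        moreover have "d = {u, v}" if "u \<rightarrow>\<^bsub>G\<^esub> v" using d(1) that by (simp add: E_def edge_iff)
        moreover have "\<not> d \<subseteq> T" if "\<not> u \<rightarrow>\<^bsub>G\<^esub> v"
          using d(1) that out_uv by (auto simp: E_def edge_iff)
        moreover have "d = {x, y}" if "x \<rightarrow>\<^bsub>G\<^esub> y" using d(2) that by (simp add: E_def edge_iff)
        moreover have "\<not> d \<subseteq> T" if "\<not> x \<rightarrow>\<^bsub>G\<^esub> y"
          using d(2) that out_xy by (auto simp: E_def edge_iff)
        ultimately show False using neq uv xy by blast
      next
        case False
        then obtain a b where ab: "a \<in> {u, v}" "b \<in> {x, y}" "{a, m {u, v}} = {b, m {x, y}}"
          using d by (auto simp: E_def edge_iff)
        have "a \<in> T" "b \<in> T" using ab uv xy by auto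
        then have "a = b" and m_eq: "m {u, v} = m {x, y}"
          using ab(3) out_uv out_xy False by (auto simp: doubleton_eq_iff)
        then obtain v' y' where "{u, v} = {a, v'}" "{x, y} = {a, y'}"
          using ab by blast
        moreover from this have "v' \<in> T" "y' \<in> T" "a \<noteq> v'" "a \<noteq> y'" "\<not> a \<rightarrow>\<^bsub>G\<^esub> v'" "\<not> a \<rightarrow>\<^bsub>G\<^esub> y'"
          using uv xy False out_uv out_xy by (auto simp: doubleton_eq_iff)
        ultimately show False
          using same_mid[of a v' y'] \<open>a \<in> T\<close> neq m_eq by simp
      qed
    qed
  qed
  then have "is_strong_immersion ?H G \<phi> P"
    using P inj img T
    unfolding is_strong_immersion_def is_immersion_def verts_H by simp
  then show ?thesis unfolding contains_strong_immersion_def by blast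
qed

lemma strong_immersion_of_clique:
  assumes "graph G" "T \<subseteq> verts G" "\<And>u v. \<lbrakk>u \<in> T; v \<in> T; u \<noteq> v\<rbrakk> \<Longrightarrow> u \<rightarrow>\<^bsub>G\<^esub> v"
  shows "contains_strong_immersion G (with_proj (complete_graph (card T)))"
  by (rule strong_immersion_through_midpoints[OF assms(1,2), where m = "\<lambda>_. undefined"])
    (use assms(3) in blast)+

text \<open>
  Being adjacent to an end \<open>u\<close> excludes as a midpoint only the non-neighbours of \<open>u\<close> outside \<open>T\<close>,
  so each non-neighbour of \<open>u\<close> inside \<open>T\<close>, which creates a conflict, also saves a colour. This is
  why \<open>T\<close> can be arbitrary.
\<close>

lemma strong_immersion_of_few_non_neighbours:
  fixes G :: "('a, 'b) pre_digraph"
  assumes "graph G" and T: "T \<subseteq> verts G" and size: "3 * card T \<le> card (verts G) + 2"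
    and few: "\<And>u. u \<in> T \<Longrightarrow> card (non_neighbours G u) < card T"
  shows "contains_strong_immersion G (with_proj (complete_graph (card T)))"
proof -
  interpret graph G by fact
  let ?N = "non_neighbours G"
  have fin_T: "finite T" using T finite_subset finite_verts by blast
  have fin_N: "finite (?N u)" for u by (simp add: non_neighbours_def)
  define E where "E = {{u, v} | u v. u \<in> T \<and> v \<in> T \<and> u \<noteq> v \<and> \<not> u \<rightarrow>\<^bsub>G\<^esub> v}"
  define L where "L e = {w \<in> verts G - T. \<forall>x\<in>e. x \<rightarrow>\<^bsub>G\<^esub> w}" for e
  have fin_E: "finite E"
    by (rule finite_subset[of _ "Pow T"]) (use fin_T in \<open>auto simp: E_def\<close>)
  have list: "card {f \<in> E. f \<noteq> e \<and> e \<inter> f \<noteq> {}} < card (L e)" if "e \<in> E" for e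
  proof -
    obtain u v where uv: "e = {u, v}" "u \<in> T" "v \<in> T" "u \<noteq> v" "\<not> u \<rightarrow>\<^bsub>G\<^esub> v"
      using \<open>e \<in> E\<close> by (auto simp: E_def)
    have vu: "\<not> v \<rightarrow>\<^bsub>G\<^esub> u" using uv graph_symmetric by blast
    let ?A = "?N u \<inter> T" and ?B = "?N v \<inter> T"
    have "v \<in> ?A" "u \<in> ?B" using uv vu T by (auto simp: non_neighbours_def)
    \<comment> \<open>The conflicts caused by an end of \<open>e\<close> are its non-neighbours in \<open>T\<close> other than the second
      end of \<open>e\<close>; the colours missing from the list of \<open>e\<close> are the non-neighbours outside \<open>T\<close>.\<close>
    have split: "card (?N x - T) + card (?N x \<inter> T) = card (?N x)" for x
      using card_Int_Diff[OF fin_N, of x T] by simp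
    have "{f \<in> E. f \<noteq> e \<and> e \<inter> f \<noteq> {}} \<subseteq> (\<lambda>x. {u, x}) ` (?A - {v}) \<union> (\<lambda>x. {v, x}) ` (?B - {u})"
    proof
      fix f assume "f \<in> {f \<in> E. f \<noteq> e \<and> e \<inter> f \<noteq> {}}"
      then have f: "f \<in> E" "f \<noteq> {u, v}" "e \<inter> f \<noteq> {}" by (simp_all add: uv(1))
      from f(3) obtain z where z: "z \<in> f" "z = u \<or> z = v"
        unfolding uv(1) by blast
      obtain a b where ab: "f = {a, b}" "a \<in> T" "b \<in> T" "a \<noteq> b" "\<not> a \<rightarrow>\<^bsub>G\<^esub> b"
        using f(1) unfolding E_def by blast
      have "\<not> b \<rightarrow>\<^bsub>G\<^esub> a" using ab(5) graph_symmetric by blast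
      then have ab_N: "b \<in> ?N a \<inter> T" "a \<in> ?N b \<inter> T"
        using ab T by (simp_all add: non_neighbours_def subset_iff)
      obtain x where x: "f = {z, x}" "x \<in> ?N z \<inter> T"
      proof (cases "z = a")
        case True
        then show thesis using that[of b] ab(1) ab_N(1) by simp
      next
        case False
        then have "z = b" using z(1) ab(1) by simp
        then show thesis using that[of a] ab(1) ab_N(2) by (simp add: insert_commute)
      qed
      show "f \<in> (\<lambda>x. {u, x}) ` (?A - {v}) \<union> (\<lambda>x. {v, x}) ` (?B - {u})"
      proof (cases "z = u")
        case True
        then have "x \<in> ?A - {v}" using x f(2) by auto
        then show ?thesis using x(1) True by simp
      next
        case False
        then have "z = v" using z(2) by simp
        then have "x \<in> ?B - {u}" using x f(2) by (auto simp: insert_commute)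
        then show ?thesis using x(1) \<open>z = v\<close> by simp
      qed
    qed
    then have "card {f \<in> E. f \<noteq> e \<and> e \<inter> f \<noteq> {}}
        \<le> card ((\<lambda>x. {u, x}) ` (?A - {v}) \<union> (\<lambda>x. {v, x}) ` (?B - {u}))"
      by (rule card_mono[rotated]) (use fin_N in auto)
    also have "\<dots> \<le> card ((\<lambda>x. {u, x}) ` (?A - {v})) + card ((\<lambda>x. {v, x}) ` (?B - {u}))"
      by (rule card_Un_le)
    also have "\<dots> \<le> card (?A - {v}) + card (?B - {u})"
      by (intro add_mono card_image_le) (use fin_N in auto)
    also have "\<dots> = (card ?A - 1) + (card ?B - 1)"
      using \<open>v \<in> ?A\<close> \<open>u \<in> ?B\<close> by simp
    also have "\<dots> < card ?A + card ?B"
    proof -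
      have "0 < card ?A" using \<open>v \<in> ?A\<close> fin_N[of u] by (auto simp only: card_gt_0_iff)
      then show ?thesis by linarith
    qed
    also have "\<dots> \<le> card (L e)"
    proof -
      have "verts G - T \<subseteq> L e \<union> ((?N u - T) \<union> (?N v - T))"
        using uv by (auto simp: L_def non_neighbours_def)
      then have "card (verts G - T) \<le> card (L e \<union> ((?N u - T) \<union> (?N v - T)))"
        by (rule card_mono[rotated]) (use fin_N in \<open>auto simp: L_def\<close>)
      also have "\<dots> \<le> card (L e) + card ((?N u - T) \<union> (?N v - T))"
        by (rule card_Un_le)
      also have "\<dots> \<le> card (L e) + (card (?N u - T) + card (?N v - T))"
        using card_Un_le[of "?N u - T" "?N v - T"] by simp
      finally have "card (verts G - T) \<le> card (L e) + (card (?N u - T) + card (?N v - T))" .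
      moreover have "card (verts G - T) = card (verts G) - card T"
        using card_Diff_subset[OF fin_T T] .
      ultimately show ?thesis
        using split[of u] split[of v] few[OF \<open>u \<in> T\<close>] few[OF \<open>v \<in> T\<close>] size by linarith
    qed
    finally show ?thesis .
  qed
  have "\<exists>m. (\<forall>e\<in>E. m e \<in> L e) \<and>
      (\<forall>e\<in>E. \<forall>f\<in>E. e \<noteq> f \<longrightarrow> e \<inter> f \<noteq> {} \<longrightarrow> m e \<noteq> m f)"
    by (rule greedy_list_colouring[where conflict = "\<lambda>e f. e \<inter> f \<noteq> {}", OF fin_E _ list])
      (auto simp only: Int_commute)
  then obtain m where m_L: "\<forall>e\<in>E. m e \<in> L e"
    and m_proper: "\<forall>e\<in>E. \<forall>f\<in>E. e \<noteq> f \<longrightarrow> e \<inter> f \<noteq> {} \<longrightarrow> m e \<noteq> m f"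
    by blast
  show ?thesis
  proof (rule strong_immersion_through_midpoints[OF \<open>graph G\<close> T, where m = m])
    fix u v assume "u \<in> T" "v \<in> T" "u \<noteq> v" "\<not> u \<rightarrow>\<^bsub>G\<^esub> v"
    then have "{u, v} \<in> E" by (auto simp: E_def)
    then show "m {u, v} \<in> verts G - T \<and> u \<rightarrow>\<^bsub>G\<^esub> m {u, v} \<and> v \<rightarrow>\<^bsub>G\<^esub> m {u, v}"
      using m_L by (auto simp: L_def)
  next
    fix u v w
    assume "u \<in> T" "v \<in> T" "w \<in> T" "u \<noteq> v" "u \<noteq> w" "v \<noteq> w" "\<not> u \<rightarrow>\<^bsub>G\<^esub> v" "\<not> u \<rightarrow>\<^bsub>G\<^esub> w"
    then have "{u, v} \<in> E" "{u, w} \<in> E" "{u, v} \<noteq> {u, w}" "{u, v} \<inter> {u, w} \<noteq> {}"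
      by (auto simp: E_def doubleton_eq_iff)
    then show "m {u, v} \<noteq> m {u, w}"
      using m_proper[rule_format, of "{u, v}" "{u, w}"] by blast
  qed
qed

lemma non_neighbours_clique:
  assumes "graph G" "independence_number G \<le> 2" "u \<in> verts G"
    and x: "x \<in> non_neighbours G u" and y: "y \<in> non_neighbours G u" and "x \<noteq> y"
  shows "x \<rightarrow>\<^bsub>G\<^esub> y"
proof (rule ccontr)
  interpret graph G by fact
  assume "\<not> x \<rightarrow>\<^bsub>G\<^esub> y"
  then have "independent_set G {u, x, y}"
    using assms graph_symmetric adj_not_same
    by (auto simp: independent_set_def non_neighbours_def)
  moreover have "finite {card S | S. independent_set G S}"
    by (rule finite_subset[of _ "card ` Pow (verts G)"]) (auto simp: independent_set_def)
  ultimately have "card {u, x, y} \<le> independence_number G"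
    unfolding independence_number_def by (intro Max_ge) auto
  moreover have "card {u, x, y} = 3" using x y \<open>x \<noteq> y\<close> by (auto simp: non_neighbours_def)
  ultimately show False using assms(2) by simp
qed

theorem theorem1p6:
  fixes G :: "('a, 'b) pre_digraph" and n :: nat
  assumes "graph G"
    and "card (verts G) = n"
    and "independence_number G \<le> 2"
  shows "contains_strong_immersion G (with_proj (complete_graph (nat \<lceil>real n / 3\<rceil>)))"
proof -
  interpret graph G by fact
  define t where "t = nat \<lceil>real n / 3\<rceil>"
  have t: "3 * t \<le> n + 2" "t \<le> n" unfolding t_def by linarith+
  show ?thesis
  proof (cases "\<exists>u\<in>verts G. t \<le> card (non_neighbours G u)")
    case True
    then obtain u T where "u \<in> verts G" "T \<subseteq> non_neighbours G u" "card T = t"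
      by (meson obtain_subset_with_card_n)
    moreover from this have "T \<subseteq> verts G" by (auto simp: non_neighbours_def)
    moreover from calculation have "x \<rightarrow>\<^bsub>G\<^esub> y" if "x \<in> T" "y \<in> T" "x \<noteq> y" for x y
      using non_neighbours_clique[OF \<open>graph G\<close> assms(3)] that by blast
    ultimately show ?thesis
      using strong_immersion_of_clique[OF \<open>graph G\<close>, of T] by (simp add: t_def)
  next
    case False
    obtain T where "T \<subseteq> verts G" "card T = t"
      using t assms(2) obtain_subset_with_card_n by metis
    then show ?thesis
      using strong_immersion_of_few_non_neighbours[OF \<open>graph G\<close>, of T] False t assms(2)
      by (force simp: t_def not_le)
  qed
qed

end
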